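(* Let $M$ and $N$ be matroids on disjoint finite sets $S$ and $T$. Let $M_q$ be a quotient of $M$ with $r(M)-r(M_q)=i$, and let $N^l$ be a lift of $N$. Set $Q=M_q\oplus N$ and $L=M\oplus N^l$ (matroids on $S\cup T$). Then (1) $Q$ is a quotient of $L$, and (2) the Higgs lift $H^i_{Q,L}$ is a semidirect sum of $M$ and $N$.
   Context: A quotient of a matroid $L$ on $E$ is a matroid $Q$ on $E$ such that $\mathrm{cl}_L(F)\subseteq\mathrm{cl}_Q(F)$ for all $F\subseteq E$; then $L$ is called a lift of $Q$. If $Q$ is a quotient of $L$ and $0\le i\le r(L)-r(Q)$, the $i$-th Higgs lift $H^i_{Q,L}$ of $Q$ toward $L$ is the matroid on $E$ with rank function $r(W)=\min\{r_Q(W)+i,\,r_L(W)\}$; for $i<0$ one sets $H^i_{Q,L}=Q$ and for $i>r(L)-r(Q)$ one sets $H^i_{Q,L}=L$. A semidirect sum of matroids $M$ on $S$ and $N$ on $T$ is a matroid $K$ on $S\cup T$ with $K|S=M$ and $K/S=N$. *)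

theory Defs
  imports Main
begin

record 'a matroid =
  ground :: "'a set"
  indep :: "'a set set"

text \<open>Since \<open>indep M\<close> only contains subsets of \<open>ground M\<close>, equality of matroids is
  equality of the underlying records.\<close>

locale matroid =
  fixes M :: "'a matroid"
  assumes finite_ground: "finite (ground M)"
    and indep_subset: "I \<in> indep M \<Longrightarrow> I \<subseteq> ground M"
    and empty_indep: "{} \<in> indep M"
    and indep_mono: "I \<in> indep M \<Longrightarrow> J \<subseteq> I \<Longrightarrow> J \<in> indep M"
    and augmentation:
      "I \<in> indep M \<Longrightarrow> J \<in> indep M \<Longrightarrow> card I < card J \<Longrightarrow>
        \<exists>x \<in> J - I. insert x I \<in> indep M"

definition rank :: "'a matroid \<Rightarrow> 'a set \<Rightarrow> nat" where
  "rank M W = Max (card ` {I \<in> indep M. I \<subseteq> W})"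

definition cl :: "'a matroid \<Rightarrow> 'a set \<Rightarrow> 'a set" where
  "cl M F = {x \<in> ground M. rank M (insert x F) = rank M F}"

definition restriction :: "'a matroid \<Rightarrow> 'a set \<Rightarrow> 'a matroid" where
  "restriction M A = \<lparr>ground = A, indep = {I \<in> indep M. I \<subseteq> A}\<rparr>"

definition basis_in :: "'a matroid \<Rightarrow> 'a set \<Rightarrow> 'a set \<Rightarrow> bool" where
  "basis_in M A B \<longleftrightarrow> B \<in> indep M \<and> B \<subseteq> A \<and> (\<forall>J \<in> indep M. B \<subseteq> J \<and> J \<subseteq> A \<longrightarrow> J = B)"

definition contraction :: "'a matroid \<Rightarrow> 'a set \<Rightarrow> 'a matroid" where
  "contraction M A =
    \<lparr>ground = ground M - A,
     indep = {I. I \<subseteq> ground M - A \<and> (\<exists>B. basis_in M A B \<and> I \<union> B \<in> indep M)}\<rparr>"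

text \<open>Only used for matroids on disjoint ground sets.\<close>

definition direct_sum :: "'a matroid \<Rightarrow> 'a matroid \<Rightarrow> 'a matroid" where
  "direct_sum M N =
    \<lparr>ground = ground M \<union> ground N, indep = {I \<union> J | I J. I \<in> indep M \<and> J \<in> indep N}\<rparr>"

definition quotient_of :: "'a matroid \<Rightarrow> 'a matroid \<Rightarrow> bool" where
  "quotient_of Q L \<longleftrightarrow>
    matroid Q \<and> matroid L \<and> ground Q = ground L \<and> (\<forall>F \<subseteq> ground L. cl L F \<subseteq> cl Q F)"

abbreviation lift_of :: "'a matroid \<Rightarrow> 'a matroid \<Rightarrow> bool" where
  "lift_of L Q \<equiv> quotient_of Q L"

text \<open>The \<open>i\<close>-th Higgs lift of \<open>Q\<close> toward \<open>L\<close>. A matroid is determined by its ground set and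
  its rank function, so the description below has at most one solution; that it has one when
  \<open>Q\<close> is a quotient of \<open>L\<close> is a theorem of Higgs. When \<open>Q\<close> is not a quotient of \<open>L\<close> the value
  is of no interest.\<close>

definition higgs_lift :: "int \<Rightarrow> 'a matroid \<Rightarrow> 'a matroid \<Rightarrow> 'a matroid" where
  "higgs_lift i Q L =
    (if i < 0 then Q
     else if i > int (rank L (ground L)) - int (rank Q (ground Q)) then L
     else (THE H. matroid H \<and> ground H = ground L \<and>
             (\<forall>W \<subseteq> ground L. int (rank H W) = min (int (rank Q W) + i) (int (rank L W)))))"

definition semidirect_sum :: "'a matroid \<Rightarrow> 'a matroid \<Rightarrow> 'a matroid \<Rightarrow> bool" where
  "semidirect_sum K M N \<longleftrightarrow>
    matroid K \<and> ground K = ground M \<union> ground N \<and>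
    restriction K (ground M) = M \<and> contraction K (ground M) = N"

end

theory Submission
  imports Defs
begin

text \<open>A quotient \<open>Q\<close> of \<open>L\<close> is characterised by rank increments along \<open>A \<subseteq> B\<close> being at most
  those of \<open>L\<close>; equivalently the gap \<open>r\<^sub>L - r\<^sub>Q\<close> is monotone, and this is what makes
  \<open>min (r\<^sub>Q + i) r\<^sub>L\<close> submodular. For \<open>Q = M\<^sub>q \<oplus> N\<close> and \<open>L = M \<oplus> N\<^sub>l\<close> the gap on a subset of \<open>S\<close> is
  at most \<open>i\<close>, so there the Higgs lift has the rank of \<open>M\<close>; on \<open>S \<union> I\<close> with \<open>I \<subseteq> T\<close> the gap is at
  least \<open>i\<close>, so there its rank is \<open>r\<^sub>M(S) + r\<^sub>N(I)\<close>, which identifies the contraction.\<close>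

section \<open>The rank function of a matroid\<close>

context matroid
begin

lemma finite_indep: "finite {I \<in> indep M. P I}"
  by (rule finite_subset[of _ "Pow (ground M)"]) (use finite_ground indep_subset in auto)

lemma finite_indep_set: "I \<in> indep M \<Longrightarrow> finite I"
  using finite_ground indep_subset finite_subset by blast

lemma card_le_rank: "I \<in> indep M \<Longrightarrow> I \<subseteq> W \<Longrightarrow> card I \<le> rank M W"
  unfolding rank_def by (intro Max_ge finite_imageI finite_indep) auto

lemma rank_witness: obtains I where "I \<in> indep M" "I \<subseteq> W" "card I = rank M W"
proof -
  have "rank M W \<in> card ` {I \<in> indep M. I \<subseteq> W}"
    unfolding rank_def
    by (rule Max_in) (use finite_indep empty_indep in auto)
  then show ?thesis using that by auto
qed

lemma rank_mono: "A \<subseteq> B \<Longrightarrow> rank M A \<le> rank M B"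
  by (metis card_le_rank rank_witness subset_trans)

lemma rank_le_card: "finite W \<Longrightarrow> rank M W \<le> card W"
  by (metis card_mono rank_witness)

lemma rank_empty [simp]: "rank M {} = 0"
  using rank_le_card[of "{}"] by simp

lemma rank_indep: "I \<in> indep M \<Longrightarrow> rank M I = card I"
  by (simp add: card_le_rank finite_indep_set le_antisym rank_le_card)

text \<open>A largest independent subset of \<open>I\<close> that has as many elements as
  \<open>I\<close> must be \<open>I\<close> itself. This lets independence, and hence equality of
  matroids, be checked on ranks alone.\<close>

lemma indep_iff_rank: "I \<in> indep M \<longleftrightarrow> I \<subseteq> ground M \<and> rank M I = card I"
proof
  assume I: "I \<subseteq> ground M \<and> rank M I = card I"
  obtain J where J: "J \<in> indep M" "J \<subseteq> I" "card J = rank M I" by (rule rank_witness)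
  have "J = I" using I J finite_ground by (metis card_subset_eq finite_subset)
  then show "I \<in> indep M" using J by simp
qed (auto simp: rank_indep indep_subset)

text \<open>As long as \<open>I\<close> is smaller than \<open>rank M W\<close>, augmenting it from
  a largest independent subset of \<open>W\<close> keeps it inside \<open>W\<close> and lowers the
  deficit \<open>rank M W - card I\<close>, on which the induction runs.\<close>

lemma extend_indep:
  assumes "I \<in> indep M" "I \<subseteq> W"
  obtains J where "J \<in> indep M" "I \<subseteq> J" "J \<subseteq> W" "card J = rank M W"
proof -
  have "\<exists>J \<in> indep M. I \<subseteq> J \<and> J \<subseteq> W \<and> card J = rank M W"
    using assms
  proof (induction "rank M W - card I" arbitrary: I rule: less_induct)
    case less
    show ?case
    proof (cases "card I = rank M W")
      case True
      then show ?thesis using less.prems by blast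
    next
      case False
      then have lt: "card I < rank M W" using card_le_rank less.prems by (simp add: nat_less_le)
      obtain B where B: "B \<in> indep M" "B \<subseteq> W" "card B = rank M W" by (rule rank_witness)
      obtain x where x: "x \<in> B - I" "insert x I \<in> indep M"
        using augmentation[OF less.prems(1) B(1)] lt B(3) by auto
      have "card (insert x I) = Suc (card I)"
        using x less.prems finite_indep_set by simp
      then have "rank M W - card (insert x I) < rank M W - card I" using lt by simp
      then obtain J where "J \<in> indep M" "insert x I \<subseteq> J" "J \<subseteq> W" "card J = rank M W"
        using less.hyps[of "insert x I"] x less.prems B(2) by auto
      then show ?thesis by blast
    qed
  qed
  then show ?thesis using that by blast
qed

text \<open>Extend a largest independent \<open>I\<close> in \<open>A \<inter> B\<close> to a
  largest independent \<open>J\<close> in \<open>A \<union> B\<close>. Then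
  \<open>J \<inter> A\<close> and \<open>J \<inter> B\<close> cover \<open>J\<close> and overlap in
  a set containing \<open>I\<close>, so their sizes add up to at least
  \<open>card J + card I\<close>.\<close>

lemma rank_submodular: "rank M (A \<union> B) + rank M (A \<inter> B) \<le> rank M A + rank M B"
proof -
  obtain I where I: "I \<in> indep M" "I \<subseteq> A \<inter> B" "card I = rank M (A \<inter> B)" by (rule rank_witness)
  obtain J where J: "J \<in> indep M" "I \<subseteq> J" "J \<subseteq> A \<union> B" "card J = rank M (A \<union> B)"
    using extend_indep[of I "A \<union> B"] I by blast
  have fin: "finite J" using J finite_indep_set by simp
  have "J \<inter> A \<union> J \<inter> B = J" using J by blast
  then have "card (J \<inter> A) + card (J \<inter> B) = card J + card ((J \<inter> A) \<inter> (J \<inter> B))"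
    using card_Un_Int[of "J \<inter> A" "J \<inter> B"] fin by (metis finite_Int)
  moreover have "card I \<le> card ((J \<inter> A) \<inter> (J \<inter> B))"
    by (rule card_mono) (use fin I J in blast)+
  moreover have "card (J \<inter> X) \<le> rank M X" for X
    by (rule card_le_rank) (use indep_mono[OF J(1)] in blast)+
  note this[of A] this[of B]
  ultimately show ?thesis
    using I(3) J(4) by linarith
qed

lemma rank_Un_le: "rank M (A \<union> B) \<le> rank M A + rank M B"
  using rank_submodular[of A B] by simp

lemma rank_insert_le: "rank M (insert x A) \<le> Suc (rank M A)"
  using rank_Un_le[of "{x}" A] rank_le_card[of "{x}"] by simp

section \<open>Bases of subsets and independence in a contraction\<close>

lemma basis_inI_card:
  assumes "B \<in> indep M" "B \<subseteq> A" "card B = rank M A"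
  shows "basis_in M A B"
  unfolding basis_in_def
proof (intro conjI ballI impI)
  fix J assume J: "J \<in> indep M" "B \<subseteq> J \<and> J \<subseteq> A"
  then have "card J \<le> card B" using assms(3) card_le_rank by simp
  then show "J = B" using J card_seteq[of J B] finite_indep_set by simp
qed (use assms in auto)

lemma basis_in_card: "basis_in M A B \<Longrightarrow> card B = rank M A"
  unfolding basis_in_def by (metis extend_indep)

text \<open>All bases of \<open>A\<close> have size \<open>rank M A\<close>, so the existential over
  \<open>B\<close> in the definition of the contraction can be replaced by a rank equation that
  mentions no basis.\<close>

lemma indep_contraction_iff:
  "I \<in> indep (contraction M A) \<longleftrightarrow>
    I \<subseteq> ground M - A \<and> rank M (I \<union> A) = card I + rank M A"
proof
  assume "I \<in> indep (contraction M A)"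
  then obtain B where I: "I \<subseteq> ground M - A" and B: "basis_in M A B" "I \<union> B \<in> indep M"
    by (auto simp: contraction_def)
  have BA: "B \<subseteq> A" using B by (simp add: basis_in_def)
  have fin: "finite I" "finite B" using B(2) finite_indep_set by (meson finite_Un)+
  have "I \<inter> B = {}" using I BA by blast
  then have "card I + rank M A = card (I \<union> B)"
    using fin basis_in_card[OF B(1)] by (simp add: card_Un_disjoint)
  also have "\<dots> \<le> rank M (I \<union> A)" using B BA by (intro card_le_rank) auto
  finally have "card I + rank M A \<le> rank M (I \<union> A)" .
  moreover have "rank M (I \<union> A) \<le> card I + rank M A"
    using rank_Un_le[of I A] rank_le_card[OF fin(1)] by simp
  ultimately show "I \<subseteq> ground M - A \<and> rank M (I \<union> A) = card I + rank M A"
    using I by simp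
next
  assume *: "I \<subseteq> ground M - A \<and> rank M (I \<union> A) = card I + rank M A"
  then have fin: "finite I" using finite_ground finite_subset by blast
  obtain B where B: "B \<in> indep M" "B \<subseteq> A" "card B = rank M A" by (rule rank_witness)
  obtain J where J: "J \<in> indep M" "B \<subseteq> J" "J \<subseteq> I \<union> A" "card J = rank M (I \<union> A)"
    using extend_indep[of B "I \<union> A"] B by blast
  have basis: "basis_in M A B" using B by (rule basis_inI_card)
  \<comment> \<open>\<open>J \<inter> A\<close> is independent, lies in \<open>A\<close> and
    contains the basis \<open>B\<close>, so maximality of \<open>B\<close> applies.\<close>
  have "J \<inter> A = B"
    using basis J B unfolding basis_in_def by (metis indep_mono inf_le1 inf_le2 le_inf_iff)
  then have "J \<subseteq> I \<union> B" using J by blast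
  \<comment> \<open>By the assumed rank equation \<open>card J = card I + card B\<close>, so
    \<open>J\<close> has no room to be a proper subset of \<open>I \<union> B\<close>.\<close>
  moreover have "card (I \<union> B) \<le> card J"
    using J(4) B(3) * card_Un_le[of I B] by simp
  ultimately have "J = I \<union> B"
    using fin B(1) finite_indep_set by (intro card_seteq) auto
  then show "I \<in> indep (contraction M A)"
    using * J(1) basis by (auto simp: contraction_def)
qed

end

lemma matroid_eqI_rank:
  assumes "matroid H" "matroid K" "ground H = ground K"
    and "\<And>W. W \<subseteq> ground K \<Longrightarrow> rank H W = rank K W"
  shows "H = K"
proof -
  have "indep H = indep K"
    using assms(3,4)
    by (auto simp: matroid.indep_iff_rank[OF assms(1)] matroid.indep_iff_rank[OF assms(2)])
  then show ?thesis using assms(3) by simp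
qed

section \<open>Matroids from rank functions\<close>

locale rank_function =
  fixes E :: "'a set" and r :: "'a set \<Rightarrow> nat"
  assumes finite_E: "finite E"
    and r_le_card: "A \<subseteq> E \<Longrightarrow> r A \<le> card A"
    and r_mono: "A \<subseteq> B \<Longrightarrow> B \<subseteq> E \<Longrightarrow> r A \<le> r B"
    and r_submodular: "A \<subseteq> E \<Longrightarrow> B \<subseteq> E \<Longrightarrow> r (A \<union> B) + r (A \<inter> B) \<le> r A + r B"
begin

definition rank_matroid :: "'a matroid" where
  "rank_matroid = \<lparr>ground = E, indep = {I. I \<subseteq> E \<and> r I = card I}\<rparr>"

text \<open>Elements that individually leave the rank of \<open>I\<close> unchanged do so jointly:
  when \<open>x\<close> is added, submodularity is applied to \<open>I \<union> J\<close> and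
  \<open>insert x I\<close>, whose intersection still contains \<open>I\<close>.\<close>

lemma r_Un_eq:
  assumes "finite J" "I \<subseteq> E" "J \<subseteq> E" "\<And>x. x \<in> J \<Longrightarrow> r (insert x I) = r I"
  shows "r (I \<union> J) = r I"
  using assms
proof (induction J rule: finite_induct)
  case (insert x J)
  have IH: "r (I \<union> J) = r I" using insert by auto
  have "r ((I \<union> J) \<union> insert x I) + r ((I \<union> J) \<inter> insert x I) \<le> r (I \<union> J) + r (insert x I)"
    using insert.prems by (intro r_submodular) auto
  moreover have "r I \<le> r ((I \<union> J) \<inter> insert x I)"
    using insert.prems by (intro r_mono) auto
  moreover have "(I \<union> J) \<union> insert x I = I \<union> insert x J" by blast
  ultimately have "r (I \<union> insert x J) \<le> r I" using IH insert.prems by simp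
  moreover have "r I \<le> r (I \<union> insert x J)" using insert.prems by (intro r_mono) auto
  ultimately show ?case by simp
qed simp

text \<open>The value \<open>r (insert x I)\<close> lies between \<open>card I\<close> and
  \<open>card I + 1\<close>; missing the upper value leaves only the lower one.\<close>

lemma r_insert_eq:
  assumes "I \<subseteq> E" "r I = card I" "x \<in> E" "r (insert x I) \<noteq> card (insert x I)"
  shows "r (insert x I) = r I"
proof -
  have "finite I" using assms finite_E finite_subset by blast
  moreover have "r I \<le> r (insert x I)" "r (insert x I) \<le> card (insert x I)"
    using assms r_mono[of I "insert x I"] r_le_card[of "insert x I"] by auto
  ultimately show ?thesis using assms by (auto simp: card_insert_if split: if_splits)
qed

lemma matroid_rank_matroid: "matroid rank_matroid"
proof
  show "finite (ground rank_matroid)" by (simp add: rank_matroid_def finite_E)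
  show "I \<subseteq> ground rank_matroid" if "I \<in> indep rank_matroid" for I
    using that by (simp add: rank_matroid_def)
  show "{} \<in> indep rank_matroid" using r_le_card[of "{}"] by (simp add: rank_matroid_def)
  show "J \<in> indep rank_matroid" if "I \<in> indep rank_matroid" "J \<subseteq> I" for I J
  proof -
    have I: "I \<subseteq> E" "r I = card I" using that by (auto simp: rank_matroid_def)
    have fin: "finite I" using I finite_E finite_subset by blast
    \<comment> \<open>Splitting \<open>I\<close> into \<open>J\<close> and \<open>I - J\<close>
      gives \<open>card I \<le> r J + r (I - J)\<close>. Each summand is bounded by its cardinality
      and these add up to \<open>card I\<close>, so both bounds are attained.\<close>
    have "r (J \<union> (I - J)) + r (J \<inter> (I - J)) \<le> r J + r (I - J)"
      using I that by (intro r_submodular) auto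
    moreover have "J \<union> (I - J) = I" using that by blast
    moreover have "r (I - J) \<le> card (I - J)" "r J \<le> card J"
      using I that by (auto intro: r_le_card)
    moreover have "card I = card J + card (I - J)"
      using fin that by (metis card_Diff_subset card_mono finite_subset le_add_diff_inverse)
    ultimately have "r J = card J" using I by simp
    then show ?thesis using I that by (auto simp: rank_matroid_def)
  qed
  show "\<exists>x \<in> J - I. insert x I \<in> indep rank_matroid"
    if "I \<in> indep rank_matroid" "J \<in> indep rank_matroid" "card I < card J" for I J
  proof (rule ccontr)
    assume no: "\<not> ?thesis"
    have IJ: "I \<subseteq> E" "r I = card I" "J \<subseteq> E" "r J = card J"
      using that by (auto simp: rank_matroid_def)
    \<comment> \<open>If no element of \<open>J\<close> extends \<open>I\<close>, each of them
      leaves \<open>r I\<close> unchanged. Then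
      \<open>r (I \<union> J) = card I < card J = r J\<close>, against monotonicity.\<close>
    have "r (insert x I) = r I" if "x \<in> J" for x
    proof (cases "x \<in> I")
      case False
      then show ?thesis using no that IJ by (intro r_insert_eq) (auto simp: rank_matroid_def)
    qed (simp add: insert_absorb)
    then have "r (I \<union> J) = r I" using IJ finite_E finite_subset by (intro r_Un_eq) auto
    moreover have "r J \<le> r (I \<union> J)" using IJ by (intro r_mono) auto
    ultimately show False using IJ that(3) by simp
  qed
qed

text \<open>A largest independent \<open>I\<close> in \<open>W\<close> cannot be enlarged within
  \<open>W\<close>, so no element of \<open>W\<close> raises \<open>r I\<close>, and therefore
  \<open>r W = r I = card I\<close>.\<close>

lemma rank_rank_matroid:
  assumes "W \<subseteq> E"
  shows "rank rank_matroid W = r W"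
proof -
  interpret matroid rank_matroid by (rule matroid_rank_matroid)
  obtain I where I: "I \<in> indep rank_matroid" "I \<subseteq> W" "card I = rank rank_matroid W"
    by (rule rank_witness)
  have rI: "r I = card I" "I \<subseteq> E" using I by (auto simp: rank_matroid_def)
  have "r (insert x I) = r I" if "x \<in> W" for x
  proof (cases "x \<in> I")
    case False
    have "insert x I \<notin> indep rank_matroid"
      using card_le_rank[of "insert x I" W] I False that finite_indep_set by auto
    then show ?thesis
      using that assms rI by (intro r_insert_eq) (auto simp: rank_matroid_def)
  qed (simp add: insert_absorb)
  then have "r (I \<union> W) = r I"
    using rI assms finite_E finite_subset by (intro r_Un_eq) auto
  then show ?thesis using I rI by (simp add: sup.absorb2)
qed

end

section \<open>Quotients and Higgs lifts\<close>

text \<open>Go from \<open>A\<close> to \<open>B\<close> one element at a time. Each rank grows by 0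
  or 1 per step, and the inclusion of closures says that a step of 0 in \<open>L\<close> is a step
  of 0 in \<open>Q\<close>.\<close>

lemma quotient_rank_increment:
  assumes "quotient_of Q L" "A \<subseteq> B" "B \<subseteq> ground L"
  shows "rank Q B + rank L A \<le> rank Q A + rank L B"
proof -
  interpret Q: matroid Q using assms by (simp add: quotient_of_def)
  interpret L: matroid L using assms by (simp add: quotient_of_def)
  have "finite B" using assms L.finite_ground finite_subset by blast
  from this assms(2,3) show ?thesis
  proof (induction "B - A" arbitrary: B rule: infinite_finite_induct)
    case empty
    then show ?case by (metis Diff_eq_empty_iff add.commute order_refl subset_antisym)
  next
    case (insert x F)
    let ?B = "B - {x}"
    have x: "x \<in> B" "x \<notin> A" "F = ?B - A" using insert by auto
    have B: "insert x ?B = B" using x by blast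
    have IH: "rank Q ?B + rank L A \<le> rank Q A + rank L ?B"
      using insert.prems x by (intro insert.hyps(3)) auto
    have "rank L B = rank L ?B \<longrightarrow> rank Q B = rank Q ?B"
    proof
      assume "rank L B = rank L ?B"
      then have "x \<in> cl L ?B" using x B insert.prems by (auto simp: cl_def)
      moreover have "cl L ?B \<subseteq> cl Q ?B"
        using assms(1) insert.prems(3) unfolding quotient_of_def by blast
      ultimately show "rank Q B = rank Q ?B" using B by (auto simp: cl_def)
    qed
    moreover have "rank L ?B \<le> rank L B" by (rule L.rank_mono) blast
    moreover have "rank Q B \<le> Suc (rank Q ?B)" using Q.rank_insert_le[of x ?B] B by simp
    ultimately show ?case using IH by linarith
  qed simp
qed

text \<open>The converse direction: membership in a closure is a zero increment from
  \<open>F\<close> to \<open>insert x F\<close>, and the increment in \<open>Q\<close> is no larger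
  than that in \<open>L\<close>.\<close>

lemma quotient_ofI_rank:
  assumes "matroid Q" "matroid L" "ground Q = ground L"
    and "\<And>A B. A \<subseteq> B \<Longrightarrow> B \<subseteq> ground L \<Longrightarrow> rank Q B + rank L A \<le> rank Q A + rank L B"
  shows "quotient_of Q L"
  unfolding quotient_of_def
proof (intro conjI allI impI subsetI)
  fix F x
  assume F: "F \<subseteq> ground L" and x: "x \<in> cl L F"
  have "rank Q (insert x F) \<le> rank Q F"
    using assms(4)[of F "insert x F"] F x by (auto simp: cl_def)
  moreover have "rank Q F \<le> rank Q (insert x F)"
    using assms(1) by (rule matroid.rank_mono) blast
  ultimately show "x \<in> cl Q F" using x assms(3) by (simp add: cl_def)
qed (use assms in auto)

section \<open>Existence and rank function of the Higgs lift\<close>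

lemma rank_function_higgs:
  assumes "quotient_of Q L"
  shows "rank_function (ground L) (\<lambda>W. min (rank Q W + k) (rank L W))"
proof
  interpret Q: matroid Q using assms by (simp add: quotient_of_def)
  interpret L: matroid L using assms by (simp add: quotient_of_def)
  show "finite (ground L)" by (rule L.finite_ground)
  show "min (rank Q A + k) (rank L A) \<le> card A" if "A \<subseteq> ground L" for A
    using L.rank_le_card[of A] that L.finite_ground finite_subset by (metis min.coboundedI2)
  show "min (rank Q A + k) (rank L A) \<le> min (rank Q B + k) (rank L B)" if "A \<subseteq> B" for A B
    using Q.rank_mono[OF that] L.rank_mono[OF that] by linarith
  \<comment> \<open>If both minima on the right are attained by the same matroid, its own
    submodularity suffices. If \<open>A\<close> uses \<open>Q\<close> and \<open>B\<close> uses
    \<open>L\<close>, add submodularity of \<open>Q\<close> to the increment inequality for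
    \<open>A \<inter> B \<subseteq> B\<close>; the other mixed case uses
    \<open>A \<inter> B \<subseteq> A\<close>.\<close>
  show "min (rank Q (A \<union> B) + k) (rank L (A \<union> B)) + min (rank Q (A \<inter> B) + k) (rank L (A \<inter> B))
      \<le> min (rank Q A + k) (rank L A) + min (rank Q B + k) (rank L B)"
    if "A \<subseteq> ground L" "B \<subseteq> ground L" for A B
    using Q.rank_submodular[of A B] L.rank_submodular[of A B]
      quotient_rank_increment[OF assms Int_lower1 that(1), of B]
      quotient_rank_increment[OF assms Int_lower2 that(2), of A]
    by linarith
qed

lemma higgs_lift_properties:
  assumes Q: "quotient_of Q L" and k: "rank Q (ground Q) + k \<le> rank L (ground L)"
  shows matroid_higgs_lift: "matroid (higgs_lift (int k) Q L)"
    and ground_higgs_lift: "ground (higgs_lift (int k) Q L) = ground L"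
    and rank_higgs_lift: "W \<subseteq> ground L \<Longrightarrow>
      rank (higgs_lift (int k) Q L) W = min (rank Q W + k) (rank L W)"
proof -
  interpret R: rank_function "ground L" "\<lambda>W. min (rank Q W + k) (rank L W)"
    using Q by (rule rank_function_higgs)
  let ?P = "\<lambda>H. matroid H \<and> ground H = ground L \<and>
    (\<forall>W \<subseteq> ground L. int (rank H W) = min (int (rank Q W) + int k) (int (rank L W)))"
  have P: "?P R.rank_matroid"
    using R.matroid_rank_matroid R.rank_rank_matroid
    by (auto simp: R.rank_matroid_def)
  have "\<exists>!H. ?P H"
  proof (rule ex1I)
    show "?P R.rank_matroid" by (rule P)
    show "H = R.rank_matroid" if "?P H" for H
    proof (rule matroid_eqI_rank)
      fix W assume "W \<subseteq> ground R.rank_matroid"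
      then have "W \<subseteq> ground L" using P by simp
      then have "int (rank H W) = int (rank R.rank_matroid W)" using that P by metis
      then show "rank H W = rank R.rank_matroid W" by simp
    qed (use that P in auto)
  qed
  then have "?P (THE H. ?P H)" by (rule theI')
  \<comment> \<open>The bound on \<open>k\<close> excludes the default value \<open>L\<close> of the
    definition, and \<open>int k\<close> is never negative, so the definite description is the
    branch taken.\<close>
  moreover have "higgs_lift (int k) Q L = (THE H. ?P H)"
    using k by (simp add: higgs_lift_def)
  ultimately have H: "?P (higgs_lift (int k) Q L)" by simp
  then show "matroid (higgs_lift (int k) Q L)" "ground (higgs_lift (int k) Q L) = ground L"
    by blast+
  show "rank (higgs_lift (int k) Q L) W = min (rank Q W + k) (rank L W)" if "W \<subseteq> ground L"
  proof -
    have "int (rank (higgs_lift (int k) Q L) W) = min (int (rank Q W) + int k) (int (rank L W))"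
      using H that by blast
    then show ?thesis by linarith
  qed
qed

section \<open>Direct sums\<close>

lemma ground_direct_sum [simp]: "ground (direct_sum M N) = ground M \<union> ground N"
  by (simp add: direct_sum_def)

context
  fixes M N :: "'a matroid"
  assumes M: "matroid M" and N: "matroid N" and disj: "ground M \<inter> ground N = {}"
begin

interpretation M: matroid M by (rule M)
interpretation N: matroid N by (rule N)

lemma indep_direct_sum_Un:
  "I \<in> indep M \<Longrightarrow> J \<in> indep N \<Longrightarrow> I \<union> J \<in> indep (direct_sum M N)"
  by (auto simp: direct_sum_def)

lemma indep_direct_sumE:
  assumes "I \<in> indep (direct_sum M N)"
  obtains I1 I2 where "I = I1 \<union> I2" "I1 \<in> indep M" "I2 \<in> indep N" "I1 \<inter> I2 = {}"
    "card I = card I1 + card I2"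
proof -
  obtain I1 I2 where I: "I = I1 \<union> I2" "I1 \<in> indep M" "I2 \<in> indep N"
    using assms by (auto simp: direct_sum_def)
  moreover have "I1 \<inter> I2 = {}" using I M.indep_subset N.indep_subset disj by blast
  ultimately show ?thesis
    using that M.finite_indep_set N.finite_indep_set by (simp add: card_Un_disjoint)
qed

lemma matroid_direct_sum: "matroid (direct_sum M N)"
proof
  show "finite (ground (direct_sum M N))" by (simp add: M.finite_ground N.finite_ground)
  show "I \<subseteq> ground (direct_sum M N)" if "I \<in> indep (direct_sum M N)" for I
    using that M.indep_subset N.indep_subset by (fastforce simp: direct_sum_def)
  show "{} \<in> indep (direct_sum M N)"
    using indep_direct_sum_Un[OF M.empty_indep N.empty_indep] by simp
  show "J \<in> indep (direct_sum M N)" if I_indep: "I \<in> indep (direct_sum M N)" and J_sub: "J \<subseteq> I" for I J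
  proof -
    obtain I1 I2 where I: "I = I1 \<union> I2" "I1 \<in> indep M" "I2 \<in> indep N"
      using indep_direct_sumE[OF I_indep] by metis
    have "(J \<inter> I1) \<union> (J \<inter> I2) \<in> indep (direct_sum M N)"
      using I M.indep_mono N.indep_mono by (intro indep_direct_sum_Un) auto
    moreover have "(J \<inter> I1) \<union> (J \<inter> I2) = J" using I J_sub by blast
    ultimately show ?thesis by simp
  qed
  show "\<exists>x \<in> J - I. insert x I \<in> indep (direct_sum M N)"
    if I_indep: "I \<in> indep (direct_sum M N)" and J_indep: "J \<in> indep (direct_sum M N)"
      and less: "card I < card J" for I J
  proof -
    obtain I1 I2 where I: "I = I1 \<union> I2" "I1 \<in> indep M" "I2 \<in> indep N"
        "card I = card I1 + card I2"
      using indep_direct_sumE[OF I_indep] by metis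
    obtain J1 J2 where J: "J = J1 \<union> J2" "J1 \<in> indep M" "J2 \<in> indep N"
        "card J = card J1 + card J2"
      using indep_direct_sumE[OF J_indep] by metis
    have sub: "I1 \<subseteq> ground M" "J1 \<subseteq> ground M" "I2 \<subseteq> ground N" "J2 \<subseteq> ground N"
      using I J M.indep_subset N.indep_subset by blast+
    \<comment> \<open>One summand of \<open>J\<close> must be larger than that of \<open>I\<close>.
      An element gained there is outside all of \<open>I\<close>, because the ground sets are
      disjoint.\<close>
    consider "card I1 < card J1" | "card I2 < card J2" using less I(4) J(4) by linarith
    then show ?thesis
    proof cases
      case 1
      then obtain x where x: "x \<in> J1 - I1" "insert x I1 \<in> indep M"
        using M.augmentation I J by blast
      then have "x \<in> J - I" using I J sub disj by blast
      moreover have "insert x I \<in> indep (direct_sum M N)"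
        using indep_direct_sum_Un[OF x(2) I(3)] I(1) by simp
      ultimately show ?thesis by blast
    next
      case 2
      then obtain x where x: "x \<in> J2 - I2" "insert x I2 \<in> indep N"
        using N.augmentation I J by blast
      then have "x \<in> J - I" using I J sub disj by blast
      moreover have "insert x I \<in> indep (direct_sum M N)"
        using indep_direct_sum_Un[OF I(2) x(2)] I(1) by simp
      ultimately show ?thesis by blast
    qed
  qed
qed

lemma rank_direct_sum:
  "rank (direct_sum M N) W = rank M (W \<inter> ground M) + rank N (W \<inter> ground N)"
proof (rule antisym)
  interpret D: matroid "direct_sum M N" by (rule matroid_direct_sum)
  obtain I where I: "I \<in> indep (direct_sum M N)" "I \<subseteq> W" "card I = rank (direct_sum M N) W"
    by (rule D.rank_witness)
  obtain I1 I2 where I12: "I = I1 \<union> I2" "I1 \<in> indep M" "I2 \<in> indep N"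
      "card I = card I1 + card I2"
    using indep_direct_sumE[OF I(1)] by metis
  have "card I1 \<le> rank M (W \<inter> ground M)" "card I2 \<le> rank N (W \<inter> ground N)"
    using I I12 M.indep_subset N.indep_subset by (auto intro!: M.card_le_rank N.card_le_rank)
  then show "rank (direct_sum M N) W \<le> rank M (W \<inter> ground M) + rank N (W \<inter> ground N)"
    using I I12 by simp
  obtain J1 where J1: "J1 \<in> indep M" "J1 \<subseteq> W \<inter> ground M" "card J1 = rank M (W \<inter> ground M)"
    by (rule M.rank_witness)
  obtain J2 where J2: "J2 \<in> indep N" "J2 \<subseteq> W \<inter> ground N" "card J2 = rank N (W \<inter> ground N)"
    by (rule N.rank_witness)
  have "card (J1 \<union> J2) = card J1 + card J2"
    using J1 J2 disj M.finite_indep_set N.finite_indep_set by (intro card_Un_disjoint) auto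
  moreover have "card (J1 \<union> J2) \<le> rank (direct_sum M N) W"
    using J1 J2 by (intro D.card_le_rank indep_direct_sum_Un) auto
  ultimately show "rank M (W \<inter> ground M) + rank N (W \<inter> ground N) \<le> rank (direct_sum M N) W"
    using J1 J2 by simp
qed

end

text \<open>Ranks in a direct sum add up, so adding the increment inequalities of the two summands
  gives that of the sum.\<close>

lemma quotient_of_direct_sum:
  assumes q1: "quotient_of Q1 L1" and q2: "quotient_of Q2 L2"
    and disj: "ground L1 \<inter> ground L2 = {}"
  shows "quotient_of (direct_sum Q1 Q2) (direct_sum L1 L2)"
proof (rule quotient_ofI_rank)
  have mat: "matroid Q1" "matroid L1" "matroid Q2" "matroid L2"
    and gr: "ground Q1 = ground L1" "ground Q2 = ground L2"
    using q1 q2 by (auto simp: quotient_of_def)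
  have disjQ: "ground Q1 \<inter> ground Q2 = {}" using disj gr by simp
  show "matroid (direct_sum Q1 Q2)" using mat disjQ by (intro matroid_direct_sum)
  show "matroid (direct_sum L1 L2)" using mat disj by (intro matroid_direct_sum)
  show "ground (direct_sum Q1 Q2) = ground (direct_sum L1 L2)" using gr by simp
  fix A B :: "'a set"
  assume "A \<subseteq> B"
  then have "rank Q1 (B \<inter> ground L1) + rank L1 (A \<inter> ground L1)
        \<le> rank Q1 (A \<inter> ground L1) + rank L1 (B \<inter> ground L1)"
    and "rank Q2 (B \<inter> ground L2) + rank L2 (A \<inter> ground L2)
        \<le> rank Q2 (A \<inter> ground L2) + rank L2 (B \<inter> ground L2)"
    by (intro quotient_rank_increment[OF q1] quotient_rank_increment[OF q2]; blast)+
  then show "rank (direct_sum Q1 Q2) B + rank (direct_sum L1 L2) A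
      \<le> rank (direct_sum Q1 Q2) A + rank (direct_sum L1 L2) B"
    using mat gr disj disjQ by (simp add: rank_direct_sum)
qed

section \<open>The Higgs lift of a direct sum as a semidirect sum\<close>

theorem theorem4p3:
  fixes M N M\<^sub>q N\<^sub>l Q L :: "'a matroid" and S T :: "'a set" and i :: int
  assumes "matroid M" and "ground M = S"
    and "matroid N" and "ground N = T"
    and "S \<inter> T = {}"
    and "quotient_of M\<^sub>q M"
    and "int (rank M S) - int (rank M\<^sub>q S) = i"
    and "lift_of N\<^sub>l N"
    and "Q = direct_sum M\<^sub>q N"
    and "L = direct_sum M N\<^sub>l"
  shows "quotient_of Q L \<and> semidirect_sum (higgs_lift i Q L) M N"
proof
  interpret M: matroid M by fact
  interpret N: matroid N by fact
  interpret Mq: matroid M\<^sub>q using assms(6) by (simp add: quotient_of_def)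
  interpret Nl: matroid N\<^sub>l using assms(8) by (simp add: quotient_of_def)
  have gr: "ground M\<^sub>q = S" "ground N\<^sub>l = T"
    using assms by (auto simp: quotient_of_def)
  show quot: "quotient_of Q L"
    using quotient_of_direct_sum[OF assms(6,8)] assms gr by simp
  have rankQ: "rank Q W = rank M\<^sub>q (W \<inter> S) + rank N (W \<inter> T)" for W
    using rank_direct_sum[of M\<^sub>q N] Mq.matroid_axioms assms gr by simp
  have rankL: "rank L W = rank M (W \<inter> S) + rank N\<^sub>l (W \<inter> T)" for W
    using rank_direct_sum[of M N\<^sub>l] Nl.matroid_axioms assms gr by simp
  have grQL: "ground Q = S \<union> T" "ground L = S \<union> T" using assms gr by auto
  have M_inc: "rank M\<^sub>q B + rank M A \<le> rank M\<^sub>q A + rank M B" if "A \<subseteq> B" "B \<subseteq> S" for A B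
    using quotient_rank_increment[OF assms(6)] that assms(2) by simp
  have N_le: "rank N A \<le> rank N\<^sub>l A" if "A \<subseteq> T" for A
    using quotient_rank_increment[OF assms(8), of "{}" A] that gr by simp
  \<comment> \<open>This difference of naturals is not truncated: \<open>M_inc\<close> from
    \<open>{}\<close> to \<open>S\<close> gives
    \<open>rank M\<^sub>q S \<le> rank M S\<close>.\<close>
  define k where "k = rank M S - rank M\<^sub>q S"
  have k: "rank M S = rank M\<^sub>q S + k" using M_inc[of "{}" S] by (simp add: k_def)
  then have i: "i = int k" using assms(7) by simp
  let ?K = "higgs_lift i Q L"
  have sets: "(S \<union> T) \<inter> S = S" "(S \<union> T) \<inter> T = T" by blast+
  \<comment> \<open>The left side equals \<open>rank M S + rank N T\<close>, and \<open>N_le\<close>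
    compares \<open>rank N T\<close> with \<open>rank N\<^sub>l T\<close>.\<close>
  have bound: "rank Q (ground Q) + k \<le> rank L (ground L)"
    using N_le[of T] k by (simp add: rankQ rankL grQL sets)
  interpret K: matroid ?K using matroid_higgs_lift[OF quot bound] i by simp
  have grK: "ground ?K = S \<union> T" using ground_higgs_lift[OF quot bound] i grQL by simp
  have rankK: "rank ?K W = min (rank M\<^sub>q (W \<inter> S) + rank N (W \<inter> T) + k)
      (rank M (W \<inter> S) + rank N\<^sub>l (W \<inter> T))" if "W \<subseteq> S \<union> T" for W
    using rank_higgs_lift[OF quot bound] that i grQL by (simp add: rankQ rankL)
  have rank_S: "rank ?K W = rank M W" if "W \<subseteq> S" for W
  proof -
    have "W \<inter> S = W" "W \<inter> T = {}" using that assms(5) by blast+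
    \<comment> \<open>The increment inequality from \<open>W\<close> to \<open>S\<close> reads
      \<open>rank M W \<le> rank M\<^sub>q W + k\<close>, so the minimum is its second
      argument.\<close>
    then show ?thesis using rankK[of W] M_inc[of W S] k that by auto
  qed
  have rank_ST: "rank ?K (I \<union> S) = rank N I + rank M S" if "I \<subseteq> T" for I
  proof -
    have "(I \<union> S) \<inter> S = S" "(I \<union> S) \<inter> T = I" "I \<union> S \<subseteq> S \<union> T"
      using that assms(5) by blast+
    then show ?thesis using rankK[of "I \<union> S"] N_le[OF that] k by simp
  qed
  have "I \<in> indep (restriction ?K S) \<longleftrightarrow> I \<in> indep M" for I
    using rank_S[of I] K.indep_iff_rank[of I] M.indep_iff_rank[of I] grK assms(2)
    by (auto simp: restriction_def)
  then have "indep (restriction ?K S) = indep M" by blast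
  then have restr: "restriction ?K (ground M) = M"
    using assms(2) by (simp add: restriction_def)
  have diff: "S \<union> T - S = T" using assms(5) by blast
  \<comment> \<open>The term \<open>rank M S\<close> cancels from the rank equation for the
    contraction, leaving \<open>rank N I = card I\<close>.\<close>
  have "I \<in> indep (contraction ?K S) \<longleftrightarrow> I \<in> indep N" for I
    using rank_ST[of I] rank_S[of S] K.indep_contraction_iff[of I S] N.indep_iff_rank[of I]
      grK diff assms(4) by auto
  then have "indep (contraction ?K S) = indep N" by blast
  then have contr: "contraction ?K (ground M) = N"
    using assms(2,4) by (simp add: contraction_def grK diff)
  show "semidirect_sum ?K M N"
    using K.matroid_axioms restr contr grK assms(2,4) by (simp add: semidirect_sum_def)
qed

end
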